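(* Let $P(x) \in \mathbb{Q}[x]$ be an integer-valued polynomial (i.e. $P(\mathbb{Z}) \subseteq \mathbb{Z}$) with $\deg P \ge 2$. Then for every $\varepsilon > 0$ there exists a set $A \subseteq \mathbb{N}$ with $d^*(A) > 1 - \varepsilon$ such that whenever $B \subseteq \mathbb{N}$ and $t \in \mathbb{Z}$ satisfy $$\{P(b_1) + b_2 + t : b_1, b_2 \in B,\ b_1 < b_2\} \subseteq A,$$ the set $B$ is finite.
   Context: $\mathbb{N} = \{1,2,3,\dots\}$. $d^*$ denotes the (additive) upper Banach density of a subset of $\mathbb{N}$: $d^*(A) = \lim_{N\to\infty} \sup_{M \ge 0} |A \cap \{M+1, \dots, M+N\}|/N$. *)

theory Defs
  imports "HOL-Analysis.Analysis" "HOL-Computational_Algebra.Polynomial"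
begin

definition integer_valued_poly :: "rat poly \<Rightarrow> bool" where
  "integer_valued_poly P \<longleftrightarrow> (\<forall>n::int. poly P (of_int n) \<in> \<int>)"

text \<open>The supremum is over a set of reals in \<open>[0, 1]\<close>, and the limit always exists
  (Fekete's lemma), so neither \<^const>\<open>Sup\<close> nor \<^const>\<open>lim\<close> takes a junk value here.\<close>

definition upper_banach_density :: "nat set \<Rightarrow> real" where
  "upper_banach_density A =
     lim (\<lambda>N::nat. SUP M::nat. real (card (A \<inter> {M + 1..M + N})) / real N)"

end

theory Submission
  imports Defs "HOL-Number_Theory.Cong"
begin

text \<open>If \<open>b\<^sub>1\<close> and \<open>b\<^sub>2\<close> are congruent modulo \<open>q\<close>, then \<open>P b\<^sub>1 + b\<^sub>2\<close> is a value of \<open>Q = P + X\<close>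
  modulo \<open>q\<close>, and an infinite \<open>B\<close> always contains such pairs with \<open>b\<^sub>2\<close> as large as we like.
  So it suffices to delete, for every \<open>t\<close>, all but finitely many integers that lie in \<open>t + Q(\<int>)\<close> modulo some
  \<open>q = q\<^sub>t\<close>, where \<open>q\<^sub>t\<close> is chosen such that \<open>Q\<close> takes only a tiny proportion of the residues.

  Such moduli exist because \<open>deg Q \<ge> 2\<close>. The difference \<open>Q (y + 1) - Q y\<close> is not constant, hence
  has infinitely many prime divisors \<open>p\<close>; for each of them \<open>Q\<close> is not injective modulo \<open>p\<close>, and then
  it misses at least \<open>p / (2 deg Q)\<close> residues. Multiply sufficiently many such primes.\<close>

section \<open>Power sums modulo a prime\<close>

text \<open>Telescoping \<open>(y + 1) ^ Suc k - y ^ Suc k\<close> over \<open>y < p\<close> writes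
  \<open>Suc k\<close> times the \<open>k\<close>-th power sum as \<open>p ^ Suc k\<close> minus a
  combination of lower power sums. By induction \<open>p\<close> divides all of this, and
  \<open>0 < Suc k < p\<close> lets the factor \<open>Suc k\<close> be cancelled.\<close>

lemma prime_dvd_sum_powers:
  fixes p :: nat
  assumes "prime p" "k < p - 1"
  shows "int p dvd (\<Sum>y<p. int y ^ k)"
  using assms(2)
proof (induction k rule: less_induct)
  case (less k)
  have "(\<Sum>y<p. int (Suc y) ^ Suc k - int y ^ Suc k) = int p ^ Suc k"
    using sum_lessThan_telescope[of "\<lambda>y. int y ^ Suc k" p] by simp
  moreover have "int (Suc y) ^ Suc k - int y ^ Suc k = (\<Sum>i\<le>k. of_nat (Suc k choose i) * int y ^ i)" for y
  proof -
    have "int (Suc y) ^ Suc k = (int y + 1) ^ Suc k" by (simp add: add.commute)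
    also have "\<dots> = (\<Sum>i\<le>Suc k. of_nat (Suc k choose i) * int y ^ i)"
      by (subst binomial_ring) simp
    finally show ?thesis by simp
  qed
  ultimately have "(\<Sum>y<p. \<Sum>i\<le>k. of_nat (Suc k choose i) * int y ^ i) = int p ^ Suc k" by simp
  hence "(\<Sum>i\<le>k. of_nat (Suc k choose i) * (\<Sum>y<p. int y ^ i)) = int p ^ Suc k"
    by (subst (asm) sum.swap) (simp add: sum_distrib_left)
  hence eq: "(\<Sum>i<k. of_nat (Suc k choose i) * (\<Sum>y<p. int y ^ i)) + int (Suc k) * (\<Sum>y<p. int y ^ k) = int p ^ Suc k"
    by (simp add: lessThan_Suc_atMost[symmetric])
  have "int p dvd (\<Sum>i<k. of_nat (Suc k choose i) * (\<Sum>y<p. int y ^ i))"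
    using less by (auto intro!: dvd_sum[of "{..<k}"] dvd_mult simp del: dvd_sum)
  moreover have "int p dvd int p ^ Suc k" by simp
  ultimately have "int p dvd int (Suc k) * (\<Sum>y<p. int y ^ k)"
    unfolding eq[symmetric] by (simp only: dvd_add_right_iff)
  moreover have "\<not> int p dvd int (Suc k)"
    using less.prems by (auto dest!: zdvd_imp_le)
  ultimately show ?case
    using assms(1) by (meson prime_dvd_mult_iff prime_int_nat_transfer prime_nat_int_transfer)
qed

lemma prime_dvd_sum_poly:
  fixes p :: nat and g :: "int poly"
  assumes "prime p" "degree g < p - 1"
  shows "int p dvd (\<Sum>y<p. poly g (int y))"
proof -
  have "(\<Sum>y<p. poly g (int y)) = (\<Sum>i\<le>degree g. coeff g i * (\<Sum>y<p. int y ^ i))"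
    by (simp add: poly_altdef sum_distrib_left) (rule sum.swap)
  thus ?thesis
    using assms by (auto intro!: dvd_sum[of "{..degree g}"] dvd_mult prime_dvd_sum_powers)
qed

section \<open>Values of integer polynomials modulo \<open>q\<close>\<close>

lemma poly_cong_int:
  fixes R :: "int poly"
  assumes "[a = b] (mod m)"
  shows "[poly R a = poly R b] (mod m)"
  using assms by (induction R) (auto intro!: cong_add cong_mult)

definition residue_image :: "int poly \<Rightarrow> nat \<Rightarrow> int set" where
  "residue_image R q = range (\<lambda>b. poly R b mod int q)"

lemma residue_image_subset: "q > 0 \<Longrightarrow> residue_image R q \<subseteq> {0..<int q}"
  by (auto simp: residue_image_def)

lemma finite_residue_image: "q > 0 \<Longrightarrow> finite (residue_image R q)"
  using finite_subset[OF residue_image_subset] by blast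

lemma residue_image_eq:
  assumes "q > 0"
  shows "residue_image R q = (\<lambda>y. poly R (int y) mod int q) ` {..<q}"
proof -
  have "poly R b mod int q = poly R (int (nat (b mod int q))) mod int q" "nat (b mod int q) < q" for b
    using assms poly_cong_int[of b "b mod int q" "int q" R]
    by (auto simp: cong_def nat_less_iff)
  thus ?thesis unfolding residue_image_def by (blast intro: image_eqI)
qed

text \<open>Let \<open>w x\<close> be the number of solutions of \<open>R y = x\<close> modulo \<open>p\<close>. The power sums of low
  order vanish modulo \<open>p\<close> both on all residues and on the values of \<open>R\<close>, so \<open>w - 1\<close> is orthogonal
  to all polynomials of low degree; if it is not zero, its support must be large.\<close>

lemma card_residue_image_prime:
  fixes R :: "int poly" and p :: nat
  assumes p: "prime p" and d: "degree R \<ge> 1" and y: "int p dvd poly R (y + 1) - poly R y"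
  shows "2 * degree R * card (residue_image R p) + p \<le> 2 * degree R * p"
proof -
  define f where "f = (\<lambda>y. poly R (int y) mod int p)"
  define w where "w = (\<lambda>x. card {y \<in> {..<p}. f y = int x})"
  define T where "T = {x \<in> {..<p}. w x \<noteq> 1}"
  have p1: "p > 1" using p prime_gt_1_nat by blast
  have V: "residue_image R p = f ` {..<p}"
    using residue_image_eq[of p R] p1 by (simp add: f_def)
  have frange: "nat (f y) \<in> {..<p}" "f y \<ge> 0" for y
    using p1 by (auto simp: f_def nat_less_iff)
  have sumw: "(\<Sum>y<p. h (f y)) = (\<Sum>x<p. int (w x) * h (int x))" for h :: "int \<Rightarrow> int"
  proof -
    have "(\<Sum>y<p. h (f y)) = (\<Sum>x<p. \<Sum>y\<in>{y \<in> {..<p}. nat (f y) = x}. h (f y))"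
      using frange by (intro sum.group[symmetric]) auto
    also have "\<dots> = (\<Sum>x<p. int (w x) * h (int x))"
    proof (rule sum.cong[OF refl])
      fix x assume "x \<in> {..<p}"
      have "{y \<in> {..<p}. nat (f y) = x} = {y \<in> {..<p}. f y = int x}"
        using frange(2) by auto
      thus "(\<Sum>y\<in>{y \<in> {..<p}. nat (f y) = x}. h (f y)) = int (w x) * h (int x)"
        by (simp add: w_def)
    qed
    finally show ?thesis .
  qed
  \<comment> \<open>The residues of \<open>y\<close> and \<open>y + 1\<close> are distinct modulo
    \<open>p\<close> but have the same image.\<close>
  have ninj: "\<not> inj_on f {..<p}"
  proof
    assume inj: "inj_on f {..<p}"
    let ?a = "nat (y mod int p)" and ?b = "nat ((y + 1) mod int p)"
    have "f ?a = poly R y mod int p" "f ?b = poly R (y + 1) mod int p"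
      using p1 poly_cong_int[of "y mod int p" y "int p" R]
        poly_cong_int[of "(y + 1) mod int p" "y + 1" "int p" R]
      by (auto simp: f_def cong_def)
    hence "f ?a = f ?b"
      using y by (simp add: mod_eq_dvd_iff dvd_diff_commute)
    hence "?a = ?b"
      using inj p1 by (auto simp: inj_on_def nat_less_iff)
    hence "y mod int p = (y + 1) mod int p"
      using p1 by (simp add: nat_eq_iff)
    hence "int p dvd 1" by (metis add_diff_cancel_left' mod_eq_dvd_iff)
    thus False using p1 by simp
  qed
  have "T \<noteq> {}"
  proof
    assume "T = {}"
    hence w1: "w x = 1" if "x < p" for x using that by (auto simp: T_def)
    have "inj_on f {..<p}"
    proof (rule inj_onI)
      fix a b assume ab: "a \<in> {..<p}" "b \<in> {..<p}" "f a = f b"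
      have "card {y \<in> {..<p}. f y = f a} = 1"
        using w1[of "nat (f a)"] frange[of a] by (simp add: w_def)
      then obtain c where "{y \<in> {..<p}. f y = f a} = {c}" using card_1_singletonE by blast
      thus "a = b" using ab by (metis (mono_tags, lifting) mem_Collect_eq singletonD)
    qed
    thus False using ninj by simp
  qed
  then obtain x0 where x0: "x0 \<in> T" by blast
  have finT: "finite T" by (simp add: T_def)
  \<comment> \<open>Otherwise take \<open>g\<close> vanishing on \<open>T\<close> except at
    \<open>x0\<close>: both \<open>g\<close> and its composition with \<open>R\<close> have degree
    below \<open>p - 1\<close>, so their sums over all residues vanish modulo \<open>p\<close>. In
    the difference of the two sums only the term at \<open>x0\<close> survives, since
    \<open>w - 1\<close> is zero off \<open>T\<close>; but \<open>p\<close> divides neither factor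
    of that term.\<close>
  have deg: "degree R * (card T - 1) \<ge> p - 1"
  proof (rule ccontr)
    assume "\<not> ?thesis"
    hence lt: "degree R * (card T - 1) < p - 1" by simp
    define g :: "int poly" where "g = (\<Prod>x\<in>T - {x0}. [:- int x, 1:])"
    have dg: "degree g \<le> card T - 1"
    proof -
      have "degree g \<le> (\<Sum>x\<in>T - {x0}. degree [:- int x, 1:])"
        unfolding g_def using finT degree_prod_sum_le[of "T - {x0}" "\<lambda>x. [:- int x, 1:]"] by (simp add: o_def)
      thus ?thesis using finT x0 by simp
    qed
    have "degree g < p - 1" using dg d lt
      by (metis le_trans mult_le_mono1 nat_mult_1 not_le)
    hence 1: "int p dvd (\<Sum>x<p. poly g (int x))" by (rule prime_dvd_sum_poly[OF p])
    have "degree (g \<circ>\<^sub>p R) < p - 1" using dg lt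
      by (metis degree_pcompose_le le_less_trans mult.commute mult_le_mono1)
    hence "int p dvd (\<Sum>y<p. poly (g \<circ>\<^sub>p R) (int y))" by (rule prime_dvd_sum_poly[OF p])
    moreover have "[(\<Sum>y<p. poly (g \<circ>\<^sub>p R) (int y)) = (\<Sum>y<p. poly g (f y))] (mod int p)"
      by (intro cong_sum) (auto simp: poly_pcompose f_def cong_def intro!: poly_cong_int[unfolded cong_def])
    ultimately have 2: "int p dvd (\<Sum>x<p. int (w x) * poly g (int x))"
      by (simp add: cong_dvd_iff sumw)
    have "(\<Sum>x<p. int (w x) * poly g (int x)) - (\<Sum>x<p. poly g (int x))
        = (\<Sum>x<p. (int (w x) - 1) * poly g (int x))"
      by (simp add: sum_subtractf algebra_simps)
    also have "\<dots> = (\<Sum>x\<in>{x0}. (int (w x) - 1) * poly g (int x))"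
    proof (rule sum.mono_neutral_right)
      show "\<forall>x\<in>{..<p} - {x0}. (int (w x) - 1) * poly g (int x) = 0"
      proof
        fix x assume x: "x \<in> {..<p} - {x0}"
        show "(int (w x) - 1) * poly g (int x) = 0"
        proof (cases "x \<in> T")
          case True
          thus ?thesis using x finT by (auto simp: g_def poly_prod)
        qed (use x in \<open>auto simp: T_def\<close>)
      qed
    qed (use x0 in \<open>auto simp: T_def\<close>)
    finally have "int p dvd (int (w x0) - 1) * poly g (int x0)"
      using dvd_diff[OF 2 1] by simp
    moreover have "\<not> int p dvd int (w x0) - 1"
    proof
      assume dv: "int p dvd int (w x0) - 1"
      have "w x0 \<le> card {..<p}" unfolding w_def by (intro card_mono) auto
      hence "\<bar>int (w x0) - 1\<bar> < int p" using p1 by auto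
      moreover have "int (w x0) - 1 \<noteq> 0" using x0 by (auto simp: T_def)
      ultimately show False using dv by (meson zdvd_not_zless dvd_abs_iff zero_less_abs_iff)
    qed
    moreover have "\<not> int p dvd poly g (int x0)"
    proof
      assume "int p dvd poly g (int x0)"
      then obtain x where x: "x \<in> T" "x \<noteq> x0" "int p dvd int x0 - int x"
        using finT p by (auto simp: g_def poly_prod prime_dvd_prod_iff)
      hence "\<bar>int x0 - int x\<bar> < int p" "int x0 - int x \<noteq> 0" using x0 by (auto simp: T_def)
      thus False using x(3) by (meson zdvd_not_zless dvd_abs_iff zero_less_abs_iff)
    qed
    ultimately show False using p
      by (meson prime_dvd_mult_iff prime_int_nat_transfer prime_nat_int_transfer)
  qed
  define Z where "Z = {x \<in> {..<p}. w x = 0}"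
  define M where "M = {x \<in> {..<p}. w x \<ge> 2}"
  have fins: "finite Z" "finite M" by (auto simp: Z_def M_def)
  have "T = Z \<union> M" by (auto simp: T_def Z_def M_def)
  hence cT: "card T \<le> card Z + card M" by (simp add: card_Un_le)
  \<comment> \<open>The average of \<open>w\<close> is 1, so an excess of at least 1 at each point
    of \<open>M\<close> must be balanced by the deficit of 1 at each point of \<open>Z\<close>. Thus
    at least half of \<open>T\<close> consists of missed residues, whence the factor 2 in the
    bound.\<close>
  have "(\<Sum>x<p. int (w x)) = int p" using sumw[of "\<lambda>_. 1"] by simp
  hence "0 = (\<Sum>x<p. int (w x) - 1)" by (simp add: sum_subtractf)
  also have "\<dots> \<ge> (\<Sum>x<p. (if x \<in> M then 1 else 0) - (if x \<in> Z then 1 else 0))"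
    by (intro sum_mono) (auto simp: M_def Z_def)
  also have "(\<Sum>x<p. (if x \<in> M then 1 else 0) - (if x \<in> Z then 1 else 0)) = int (card M) - int (card Z)"
  proof -
    have "{..<p} \<inter> M = M" "{..<p} \<inter> Z = Z" by (auto simp: M_def Z_def)
    thus ?thesis by (simp add: sum_subtractf sum.If_cases)
  qed
  finally have "card M \<le> card Z" by simp
  hence cT2: "card T \<le> 2 * card Z" using cT by simp
  have "card (residue_image R p) = card {x \<in> {..<p}. w x \<noteq> 0}"
  proof (rule bij_betw_same_card[of nat])
    have "nat ` residue_image R p = {x \<in> {..<p}. w x \<noteq> 0}"
    proof
      show "nat ` residue_image R p \<subseteq> {x \<in> {..<p}. w x \<noteq> 0}"
        using frange by (auto simp: V w_def)
      show "{x \<in> {..<p}. w x \<noteq> 0} \<subseteq> nat ` residue_image R p"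
      proof
        fix x assume "x \<in> {x \<in> {..<p}. w x \<noteq> 0}"
        then obtain y where "y < p" "f y = int x" by (auto simp: w_def)
        thus "x \<in> nat ` residue_image R p" unfolding V by (force simp: image_iff)
      qed
    qed
    moreover have "inj_on nat (residue_image R p)"
      using frange(2) by (auto simp: V inj_on_def) (metis nat_0_le)
    ultimately show "bij_betw nat (residue_image R p) {x \<in> {..<p}. w x \<noteq> 0}" by (simp add: bij_betw_def)
  qed
  also have "{x \<in> {..<p}. w x \<noteq> 0} = {..<p} - Z" by (auto simp: Z_def)
  also have "card ({..<p} - Z) = p - card Z"
    by (subst card_Diff_subset) (auto simp: Z_def)
  finally have cV: "card (residue_image R p) = p - card Z" .
  have Zp: "card Z \<le> p" using card_mono[of "{..<p}" Z] by (auto simp: Z_def)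
  have "card T \<ge> 1" using x0 finT by (metis One_nat_def Suc_leI card_gt_0_iff empty_iff)
  hence "degree R * card T = degree R * (card T - 1) + degree R"
    by (metis add.commute le_add_diff_inverse mult.right_neutral distrib_left)
  hence "p \<le> degree R * card T" using deg d p1 by linarith
  also have "\<dots> \<le> 2 * degree R * card Z" using cT2 by (metis mult.assoc mult.commute mult_le_mono2)
  finally have "p \<le> 2 * degree R * card Z" .
  moreover have "2 * degree R * card (residue_image R p) + 2 * degree R * card Z = 2 * degree R * p"
    using Zp by (simp add: cV flip: distrib_left)
  ultimately show ?thesis by linarith
qed

section \<open>Prime divisors of polynomial values\<close>

text \<open>By induction \<open>R\<close> agrees with a linear polynomial at every natural number,
  and a nonzero polynomial has only finitely many roots.\<close>

lemma constant_difference_imp_degree_le_1: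
  fixes R :: "int poly"
  assumes "\<And>y. poly R (y + 1) - poly R y = c"
  shows "degree R \<le> 1"
proof -
  have lin: "poly R (int n) = poly R 0 + c * int n" for n
  proof (induction n)
    case (Suc n)
    show ?case using assms[of "int n"] Suc by (simp add: algebra_simps)
  qed simp
  have "R - [:poly R 0, c:] = 0"
  proof (rule ccontr)
    assume "R - [:poly R 0, c:] \<noteq> 0"
    hence "finite {x. poly (R - [:poly R 0, c:]) x = 0}" by (rule poly_roots_finite)
    moreover have "range int \<subseteq> {x. poly (R - [:poly R 0, c:]) x = 0}"
      using lin by (auto simp: mult.commute)
    ultimately show False
      using finite_subset infinite_UNIV_char_0 finite_imageD inj_of_nat by blast
  qed
  then obtain a where "R = [:a, c:]" by (metis right_minus_eq)
  thus ?thesis using degree_pCons_le[of a "[:c:]"] by simp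
qed

text \<open>Schur's variant of Euclid's argument: at arguments \<open>c * D * z\<close> with
  \<open>c = poly S 0\<close> nonzero, the value is \<open>c\<close> times a number congruent to 1
  modulo \<open>D\<close>, and any prime factor of that number avoids \<open>D\<close>. Letting
  \<open>D\<close> absorb earlier primes yields new ones.\<close>

lemma prime_divisor_of_poly_value:
  fixes S :: "int poly" and D :: int
  assumes S: "degree S \<ge> 1" and D: "D \<noteq> 0"
  obtains p :: nat and y where "prime p" "\<not> int p dvd D" "int p dvd poly S y"
proof (cases "poly S 0 = 0")
  case True
  obtain p where p: "prime p" "p > nat \<bar>D\<bar>" using bigger_prime by blast
  hence "\<not> int p dvd D" using D by (meson dvd_abs_iff zdvd_not_zless zero_less_abs_iff nat_less_iff abs_ge_zero)
  thus ?thesis using that[of p 0] p True by simp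
next
  case False
  define c where "c = poly S 0"
  obtain a T where ST: "S = pCons a T" by (cases S)
  hence a: "a = c" by (simp add: c_def)
  have val: "poly S (c * D * z) = c * (1 + D * z * poly T (c * D * z))" for z
    by (simp add: ST a algebra_simps)
  \<comment> \<open>Otherwise \<open>S\<close> would take at most three values on the infinite set
    of multiples of \<open>c * D\<close>.\<close>
  have "\<exists>z. 1 + D * z * poly T (c * D * z) \<notin> {0, 1, -1}"
  proof (rule ccontr)
    assume "\<not> ?thesis"
    hence all: "poly S (c * D * z) \<in> {0, c, -c}" for z
      using val[of z] by (metis insertCI insertE mult.right_neutral mult_minus1_right mult_zero_right singletonD)
    have fin: "finite {x. poly S x = v}" for v
    proof -
      have "S - [:v:] \<noteq> 0" using S by (metis degree_pCons_0 eq_iff_diff_eq_0 not_one_le_zero)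
      from poly_roots_finite[OF this] show ?thesis by simp
    qed
    have "range (\<lambda>z. c * D * z) \<subseteq> {x. poly S x = 0} \<union> {x. poly S x = c} \<union> {x. poly S x = -c}"
      using all by auto
    hence "finite (range (\<lambda>z. c * D * z))" using fin by (meson finite_UnI finite_subset)
    moreover have "inj (\<lambda>z. c * D * z)" using False D by (auto simp: inj_def c_def)
    ultimately show False using finite_imageD infinite_UNIV_int by blast
  qed
  then obtain z where z: "1 + D * z * poly T (c * D * z) \<notin> {0, 1, -1}" by blast
  define n where "n = 1 + D * z * poly T (c * D * z)"
  have "nat \<bar>n\<bar> \<noteq> 1" using z unfolding n_def[symmetric] by (auto simp: abs_if split: if_splits)
  then obtain p where p: "prime p" "p dvd nat \<bar>n\<bar>" using prime_factor_nat by blast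
  hence pn: "int p dvd n" by (metis abs_ge_zero dvd_abs_iff int_dvd_int_iff nat_0_le)
  have "\<not> int p dvd D"
  proof
    assume "int p dvd D"
    hence "int p dvd 1" using pn unfolding n_def by (simp add: dvd_add_left_iff mult.assoc)
    thus False using p(1) by (metis int_dvd_int_iff of_nat_1 not_prime_unit)
  qed
  moreover have "int p dvd poly S (c * D * z)" using pn by (simp only: val n_def dvd_mult)
  ultimately show ?thesis using that p(1) by blast
qed

section \<open>Moduli with few polynomial values\<close>

text \<open>Uniqueness in the Chinese remainder theorem: a value modulo \<open>p * q\<close> is
  determined by its reductions, which are values modulo \<open>p\<close> and modulo
  \<open>q\<close>.\<close>

lemma card_residue_image_mult:
  assumes "p > 0" "q > 0" "coprime p q"
  shows "card (residue_image R (p * q)) \<le> card (residue_image R p) * card (residue_image R q)"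
proof -
  have "inj_on (\<lambda>r. (r mod int p, r mod int q)) (residue_image R (p * q))"
  proof (rule inj_onI)
    fix r s assume r: "r \<in> residue_image R (p * q)" "s \<in> residue_image R (p * q)"
      and "(r mod int p, r mod int q) = (s mod int p, s mod int q)"
    hence "int p dvd r - s" "int q dvd r - s" by (auto simp: mod_eq_dvd_iff)
    hence "int (p * q) dvd r - s" using assms by (simp add: divides_mult)
    hence "r mod int (p * q) = s mod int (p * q)" by (simp add: mod_eq_dvd_iff)
    thus "r = s" using r residue_image_subset[of "p * q" R] assms by (auto simp: subset_iff)
  qed
  moreover have "(\<lambda>r. (r mod int p, r mod int q)) ` residue_image R (p * q)
      \<subseteq> residue_image R p \<times> residue_image R q"
    by (auto simp: residue_image_def mod_mod_cancel)
  ultimately have "card (residue_image R (p * q)) \<le> card (residue_image R p \<times> residue_image R q)"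
    using assms by (intro card_inj_on_le) (auto simp: finite_residue_image)
  thus ?thesis by (simp add: card_cartesian_product)
qed

text \<open>Each new prime multiplies the proportion of attained residues by at most
  \<open>c < 1\<close>. Coprimality to \<open>D\<close> is kept so that \<open>D\<close>, the
  denominator cleared from the rational polynomial, stays invertible modulo
  \<open>q\<close>.\<close>

lemma residue_image_small:
  fixes R :: "int poly" and D :: int and \<delta> :: real
  assumes R: "degree R \<ge> 2" and D: "D \<noteq> 0" and "\<delta> > 0"
  obtains q :: nat where "q > 0" "coprime (int q) D" "real (card (residue_image R q)) \<le> \<delta> * real q"
proof -
  define c where "c = 1 - 1 / (2 * real (degree R))"
  have c: "0 \<le> c" "c < 1" using R by (auto simp: c_def field_simps)
  define S where "S = R \<circ>\<^sub>p [:1, 1:] - R"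
  have Sy: "poly S y = poly R (y + 1) - poly R y" for y by (simp add: S_def poly_pcompose add.commute)
  have degS: "degree S \<ge> 1"
  proof (rule ccontr)
    assume "\<not> ?thesis"
    then obtain s where "S = [:s:]" by (metis degree_eq_zeroE less_one not_le)
    hence "poly R (y + 1) - poly R y = s" for y by (simp flip: Sy)
    hence "degree R \<le> 1" by (rule constant_difference_imp_degree_le_1)
    thus False using R by simp
  qed
  have "\<exists>q::nat. q > 0 \<and> coprime (int q) D \<and> real (card (residue_image R q)) \<le> c ^ r * real q" for r
  proof (induction r)
    case 0
    show ?case
      using card_mono[OF _ residue_image_subset[of 1 R]] by (intro exI[of _ 1]) auto
  next
    case (Suc r)
    then obtain q where q: "q > 0" "coprime (int q) D" "real (card (residue_image R q)) \<le> c ^ r * real q" by blast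
    \<comment> \<open>Avoiding \<open>D * int q\<close> makes the prime coprime to \<open>D\<close>
      and new with respect to \<open>q\<close>.\<close>
    obtain p y where p: "prime p" "\<not> int p dvd D * int q" "int p dvd poly S y"
      using prime_divisor_of_poly_value[OF degS, of "D * int q"] D q by auto
    have p0: "p > 0" using p(1) prime_gt_0_nat by blast
    have cop: "coprime (int p) D" "coprime p q"
      using p(1,2) by (auto intro!: prime_imp_coprime)
    have "2 * degree R * card (residue_image R p) + p \<le> 2 * degree R * p"
      using card_residue_image_prime[OF p(1), of R y] p(3) R by (simp add: Sy)
    hence "2 * real (degree R) * card (residue_image R p) + p \<le> 2 * degree R * p"
      by (metis (mono_tags, opaque_lifting) of_nat_add of_nat_le_iff of_nat_mult of_nat_numeral)
    hence cp: "card (residue_image R p) \<le> c * p" using R by (simp add: c_def field_simps)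
    have "real (card (residue_image R (p * q))) \<le> real (card (residue_image R p)) * card (residue_image R q)"
      using card_residue_image_mult[OF p0 q(1) cop(2), of R] by (metis of_nat_le_iff of_nat_mult)
    also have "\<dots> \<le> (c * p) * (c ^ r * q)"
      using cp q(3) c by (intro mult_mono) auto
    finally show ?case using q cop p0 by (intro exI[of _ "p * q"]) (simp add: mult_ac)
  qed
  moreover obtain r where "c ^ r < \<delta>" using real_arch_pow_inv[OF \<open>\<delta> > 0\<close> c(2)] by blast
  ultimately obtain q where q: "q > 0" "coprime (int q) D" "real (card (residue_image R q)) \<le> c ^ r * real q"
    by blast
  have "c ^ r * real q \<le> \<delta> * real q" using \<open>c ^ r < \<delta>\<close> by (intro mult_right_mono) auto
  with q show ?thesis by (intro that[OF q(1,2)]) linarith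
qed

section \<open>Fekete's lemma and upper Banach density\<close>

text \<open>Fekete's lemma; the limit is the infimum \<open>L\<close>. For a nearly optimal
  \<open>k\<close>, division with remainder bounds \<open>a n / n\<close> by \<open>a k / k\<close>
  plus a vanishing remainder term.\<close>

lemma subadditive_div_convergent:
  fixes a :: "nat \<Rightarrow> real"
  assumes sub: "\<And>m n. a (m + n) \<le> a m + a n" and nonneg: "\<And>n. a n \<ge> 0"
  shows "convergent (\<lambda>n. a n / real n)"
proof -
  define L where "L = (INF n\<in>{1..}. a n / real n)"
  have bdd: "bdd_below ((\<lambda>n. a n / real n) ` {1..})"
    using nonneg by (intro bdd_belowI2[of _ 0]) auto
  have mult: "a (q * k + r) \<le> real q * a k + a r" for q k r
  proof (induction q)
    case (Suc q)
    show ?case using sub[of k "q * k + r"] Suc by (simp add: algebra_simps)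
  qed simp
  have "(\<lambda>n. a n / real n) \<longlonglongrightarrow> L"
  proof (rule order_tendstoI)
    fix l assume "l < L"
    show "\<forall>\<^sub>F n in sequentially. l < a n / real n"
      using eventually_ge_at_top[of 1]
    proof eventually_elim
      case (elim n)
      hence "L \<le> a n / real n" unfolding L_def by (intro cINF_lower bdd) auto
      thus ?case using \<open>l < L\<close> by simp
    qed
  next
    fix u assume "L < u"
    then obtain k where k: "k \<ge> 1" "a k / real k < u"
      unfolding L_def using bdd by (subst (asm) cINF_less_iff) auto
    define C where "C = Max (a ` {..<k})"
    have "(\<lambda>n. a k / real k + C / real n) \<longlonglongrightarrow> a k / real k + 0"
      by (intro tendsto_intros tendsto_divide_0[OF tendsto_const] filterlim_at_top_imp_at_infinity
          filterlim_real_sequentially)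
    hence "\<forall>\<^sub>F n in sequentially. a k / real k + C / real n < u"
      using k(2) by (intro order_tendstoD) auto
    with eventually_gt_at_top[of 0] show "\<forall>\<^sub>F n in sequentially. a n / real n < u"
    proof eventually_elim
      case (elim n)
      have "a n \<le> real (n div k) * a k + a (n mod k)"
        using mult[of "n div k" k "n mod k"] by simp
      also have "a (n mod k) \<le> C" unfolding C_def using k(1) by (intro Max_ge) auto
      also have "real (n div k) * a k \<le> (real n / real k) * a k"
        using nonneg of_nat_div_le_of_nat by (intro mult_right_mono) auto
      finally have "a n / real n \<le> (real n / real k * a k + C) / real n"
        by (intro divide_right_mono) auto
      also have "\<dots> = a k / real k + C / real n" using elim by (simp add: field_simps)
      finally show ?case using elim by simp
    qed
  qed
  thus ?thesis by (rule convergentI)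
qed

text \<open>The windows starting at \<open>M = 0\<close> bound every supremum from below. This
  passes to \<open>lim\<close> only once convergence is known, which follows because
  \<open>real N * s N\<close> is subadditive: a window splits into two adjacent ones.\<close>

lemma upper_banach_density_ge:
  assumes A: "\<And>N. real (card (A \<inter> {1..N})) \<ge> c * real N"
  shows "upper_banach_density A \<ge> c"
proof -
  define s where "s = (\<lambda>N. SUP M. real (card (A \<inter> {M + 1..M + N})) / real N)"
  have card_le: "card (A \<inter> {M + 1..M + N}) \<le> N" for M N
    using card_mono[of "{M + 1..M + N}" "A \<inter> {M + 1..M + N}"] by simp
  have bdd: "bdd_above (range (\<lambda>M. real (card (A \<inter> {M + 1..M + N})) / real N))" for N
    by (rule bdd_aboveI2[of _ _ 1]) (use card_le in \<open>auto simp: divide_le_eq_1\<close>)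
  have up: "real (card (A \<inter> {M + 1..M + N})) \<le> real N * s N" for M N
  proof (cases "N = 0")
    case False
    have "real (card (A \<inter> {M + 1..M + N})) / real N \<le> s N"
      unfolding s_def by (rule cSUP_upper[OF _ bdd]) simp
    thus ?thesis using False by (simp add: field_simps)
  qed simp
  have s_le: "s N \<le> u" if "\<And>M. real (card (A \<inter> {M + 1..M + N})) / real N \<le> u" for N u
    unfolding s_def using that by (intro cSUP_least) auto
  have nonneg: "real N * s N \<ge> 0" for N
    using up[of 0 N] of_nat_0_le_iff order_trans by blast
  have sub: "real (m + n) * s (m + n) \<le> real m * s m + real n * s n" for m n
  proof (cases "m + n = 0")
    case False
    have "s (m + n) \<le> (real m * s m + real n * s n) / real (m + n)"
    proof (rule s_le)
      fix M
      have "A \<inter> {M + 1..M + (m + n)} = (A \<inter> {M + 1..M + m}) \<union> (A \<inter> {(M + m) + 1..(M + m) + n})"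
        by auto
      hence "card (A \<inter> {M + 1..M + (m + n)})
          \<le> card (A \<inter> {M + 1..M + m}) + card (A \<inter> {(M + m) + 1..(M + m) + n})"
        by (metis card_Un_le)
      hence "real (card (A \<inter> {M + 1..M + (m + n)})) \<le> real m * s m + real n * s n"
        using up[of M m] up[of "M + m" n] by linarith
      thus "real (card (A \<inter> {M + 1..M + (m + n)})) / real (m + n)
          \<le> (real m * s m + real n * s n) / real (m + n)"
        by (rule divide_right_mono) simp
    qed
    thus ?thesis using False by (simp add: field_simps)
  qed simp
  have "convergent (\<lambda>n. real n * s n / real n)"
    by (rule subadditive_div_convergent[of "\<lambda>n. real n * s n"]) (use sub nonneg in auto)
  hence "convergent s"
    \<comment> \<open>Shifting the index avoids the division by zero at
      \<open>n = 0\<close>.\<close>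
    by (subst convergent_Suc_iff[symmetric], subst (asm) convergent_Suc_iff[symmetric]) simp
  hence lim: "s \<longlonglongrightarrow> upper_banach_density A"
    unfolding upper_banach_density_def s_def[symmetric] by (simp add: convergent_LIMSEQ_iff)
  have "c \<le> s N" if "N \<ge> 1" for N
  proof -
    have "c * real N \<le> s N * real N" using A[of N] up[of 0 N] by (simp add: mult.commute)
    thus ?thesis using that by simp
  qed
  thus ?thesis using LIMSEQ_le_const[OF lim] by blast
qed

section \<open>Integer coefficients and counting in residue classes\<close>

lemma clear_denominators:
  fixes Q :: "rat poly"
  obtains D :: int and R :: "int poly"
  where "D \<noteq> 0" "map_poly of_int R = smult (of_int D) Q"
proof -
  have "\<exists>(D::int) R. D \<noteq> 0 \<and> map_poly of_int R = smult (of_int D) Q"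
  proof (induction Q)
    case 0
    show ?case by (intro exI[of _ 1] exI[of _ 0]) simp
  next
    case (pCons a Q)
    then obtain D R where DR: "(D::int) \<noteq> 0" "map_poly of_int R = smult (of_int D) Q" by blast
    obtain n m where nm: "a = of_int n / of_int m" "(m::int) \<noteq> 0"
      by (metis Fract_of_int_quotient Rat_cases less_irrefl)
    have "map_poly of_int (pCons (n * D) (smult m R)) = smult (of_int (D * m)) (pCons a Q)"
      using DR nm by (simp add: map_poly_pCons map_poly_smult field_simps)
    thus ?case using DR nm by (intro exI[of _ "D * m"] exI) auto
  qed
  thus ?thesis using that by blast
qed

lemma poly_map_poly_of_int:
  "poly (map_poly of_int R) (of_int x :: rat) = of_int (poly R x)"
  by (induction R) (auto simp: map_poly_pCons)

lemma card_periodic_le: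
  fixes q N :: nat
  assumes "q > 0" "\<And>x. x \<in> E \<Longrightarrow> x mod q \<in> W" "W \<subseteq> {..<q}"
  shows "card (E \<inter> {1..N}) \<le> (N div q + 1) * card W"
proof -
  have "finite W" using assms(3) finite_subset by blast
  have "card (E \<inter> {1..N}) \<le> card ({0..N div q} \<times> W)"
  proof (rule card_inj_on_le[of "\<lambda>x. (x div q, x mod q)"])
    show "inj_on (\<lambda>x. (x div q, x mod q)) (E \<inter> {1..N})"
      by (rule inj_onI) (metis div_mult_mod_eq prod.inject)
    show "(\<lambda>x. (x div q, x mod q)) ` (E \<inter> {1..N}) \<subseteq> {0..N div q} \<times> W"
      using assms(2) by (auto intro: div_le_mono)
  qed (use \<open>finite W\<close> in simp)
  thus ?thesis by (simp add: card_cartesian_product)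
qed

text \<open>The exceptional set for the shift \<open>t\<close>: it absorbs every \<open>x = P b\<^sub>1 + b\<^sub>2 + t\<close> with
  \<open>b\<^sub>1\<close> and \<open>b\<^sub>2\<close> congruent modulo \<open>q\<close>, when \<open>R\<close> is \<open>D * (P + X)\<close>.\<close>

definition shifted_values :: "int poly \<Rightarrow> int \<Rightarrow> int \<Rightarrow> nat \<Rightarrow> nat set" where
  "shifted_values R D t q = {x. D * (int x - t) mod int q \<in> residue_image R q}"

text \<open>As \<open>D\<close> is invertible modulo \<open>q\<close>, the set occupies at most as
  many classes as \<open>residue_image R q\<close>. The factor 2 pays for the incomplete last
  period, using \<open>N \<ge> q\<close>.\<close>

lemma card_shifted_values_le:
  fixes \<delta> :: real
  assumes q: "q > 0" "coprime (int q) D" "real (card (residue_image R q)) \<le> \<delta> * real q"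
    and N: "N \<ge> q"
  shows "real (card (shifted_values R D t q \<inter> {1..N})) \<le> 2 * \<delta> * real N"
proof -
  define W where "W = {r \<in> {..<q}. r \<in> shifted_values R D t q}"
  have per: "x mod q \<in> W" if "x \<in> shifted_values R D t q" for x
  proof -
    have "[D * (int (x mod q) - t) = D * (int x - t)] (mod int q)"
      by (intro cong_mult cong_diff) (auto simp: cong_def zmod_int)
    thus ?thesis using that q(1) by (simp add: W_def shifted_values_def cong_def)
  qed
  have "card W \<le> card (residue_image R q)"
  proof (rule card_inj_on_le)
    show "inj_on (\<lambda>r. D * (int r - t) mod int q) W"
    proof (rule inj_onI)
      fix r s assume rs: "r \<in> W" "s \<in> W"
        and "D * (int r - t) mod int q = D * (int s - t) mod int q"
      hence "int q dvd D * (int r - t) - D * (int s - t)" by (simp add: mod_eq_dvd_iff)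
      also have "\<dots> = D * (int r - int s)" by (simp add: algebra_simps)
      finally have "int q dvd int r - int s" using q(2) by (simp add: coprime_dvd_mult_right_iff)
      hence "int r mod int q = int s mod int q" by (simp add: mod_eq_dvd_iff)
      thus "r = s" using rs by (simp add: W_def)
    qed
  qed (use q in \<open>auto simp: W_def shifted_values_def finite_residue_image\<close>)
  hence W: "real (card W) \<le> \<delta> * real q" using q(3) by linarith
  have "real (card (shifted_values R D t q \<inter> {1..N})) \<le> real ((N div q + 1) * card W)"
    using card_periodic_le[OF q(1) per] by (subst of_nat_le_iff) (auto simp: W_def)
  also have "\<dots> = (real (N div q) + 1) * real (card W)" by (simp add: algebra_simps)
  also have "\<dots> \<le> (real N / real q + 1) * (\<delta> * real q)"
    using W of_nat_div_le_of_nat by (intro mult_mono add_mono) auto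
  also have "\<dots> = \<delta> * real N + \<delta> * real q" using q(1) by (simp add: field_simps)
  also have "\<dots> \<le> \<delta> * real N + \<delta> * real N"
  proof -
    have "\<delta> \<ge> 0" using q by (metis of_nat_0_le_iff of_nat_0_less_iff order_trans zero_le_mult_iff not_le)
    thus ?thesis using N by (intro add_left_mono mult_left_mono) auto
  qed
  finally show ?thesis by simp
qed

section \<open>Construction of \<open>A\<close> and finiteness of \<open>B\<close>\<close>

theorem theorem1p5:
  fixes P :: "rat poly" and \<epsilon> :: real
  assumes "integer_valued_poly P" and "degree P \<ge> 2" and "\<epsilon> > 0"
  shows "\<exists>A::nat set. A \<subseteq> {1..} \<and> upper_banach_density A > 1 - \<epsilon> \<and>
    (\<forall>(B::nat set) (t::int). B \<subseteq> {1..} \<and>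
       {poly P (of_nat b1) + of_nat b2 + of_int t | b1 b2. b1 \<in> B \<and> b2 \<in> B \<and> b1 < b2}
         \<subseteq> (of_nat ` A :: rat set)
       \<longrightarrow> finite B)"
proof -
  obtain D R where D: "D \<noteq> 0" and R: "map_poly of_int R = smult (of_int D) (P + [:0, 1:])"
    by (rule clear_denominators)
  have poly_R: "of_int (poly R x) = of_int D * (poly P (of_int x) + of_int x)" for x
    using poly_map_poly_of_int[of R x] by (simp add: R)
  have "degree R = degree (map_poly of_int R :: rat poly)" by (rule degree_map_poly[symmetric]) simp
  also have "\<dots> = degree (P + [:0, 1:])" using D by (simp add: R)
  also have "\<dots> = degree P" using assms(2) by (intro degree_add_eq_left) simp
  finally have degR: "degree R \<ge> 2" using assms(2) by simp
  \<comment> \<open>Chosen so that the bounds \<open>2 * \<delta> n\<close> sum to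
    \<open>\<epsilon> / 2\<close> over all \<open>n\<close>.\<close>
  define \<delta> where "\<delta> = (\<lambda>n. \<epsilon> / 2 ^ (n + 3))"
  have "\<exists>q::nat. q > 0 \<and> coprime (int q) D \<and> real (card (residue_image R q)) \<le> \<delta> n * real q" for n
    using residue_image_small[OF degR D, of "\<delta> n"] assms(3) by (auto simp: \<delta>_def)
  then obtain q where q: "q n > 0" "coprime (int (q n)) D"
      "real (card (residue_image R (q n))) \<le> \<delta> n * real (q n)" for n by metis
  \<comment> \<open>Every shift is some \<open>int_decode n\<close>. In the cutoff,
    \<open>q n\<close> ensures \<open>N \<ge> q n\<close> whenever \<open>E n\<close> meets
    \<open>{1..N}\<close>, and \<open>n + 1\<close> ensures that only indices \<open>n < N\<close>
    matter there.\<close>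
  define E where "E = (\<lambda>n. shifted_values R D (int_decode n) (q n) \<inter> {q n + n + 1..})"
  define A where "A = {1..} - (\<Union>n. E n)"
  have cardE: "real (card (E n \<inter> {1..N})) \<le> 2 * \<delta> n * real N" for n N
  proof (cases "q n + n + 1 \<le> N")
    case True
    have "card (E n \<inter> {1..N}) \<le> card (shifted_values R D (int_decode n) (q n) \<inter> {1..N})"
      by (intro card_mono) (auto simp: E_def)
    also have "real \<dots> \<le> 2 * \<delta> n * real N"
      using True by (intro card_shifted_values_le q) auto
    finally show ?thesis by simp
  next
    case False
    hence "E n \<inter> {1..N} = {}" by (auto simp: E_def)
    thus ?thesis using assms(3) by (simp add: \<delta>_def)
  qed
  have "upper_banach_density A \<ge> 1 - \<epsilon> / 2"
  proof (rule upper_banach_density_ge)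
    fix N :: nat
    have sum\<delta>: "(\<Sum>n<k. 2 * \<delta> n) = \<epsilon> / 2 * (1 - 1 / 2 ^ k)" for k
      by (induction k) (auto simp: \<delta>_def field_simps power_add)
    have cover: "{1..N} \<subseteq> (A \<inter> {1..N}) \<union> (\<Union>n<N. E n \<inter> {1..N})"
      by (force simp: A_def E_def)
    have "N = card {1..N}" by simp
    also have "\<dots> \<le> card ((A \<inter> {1..N}) \<union> (\<Union>n<N. E n \<inter> {1..N}))"
      by (rule card_mono[OF _ cover]) auto
    also have "\<dots> \<le> card (A \<inter> {1..N}) + card (\<Union>n<N. E n \<inter> {1..N})" by (rule card_Un_le)
    also have "card (\<Union>n<N. E n \<inter> {1..N}) \<le> (\<Sum>n<N. card (E n \<inter> {1..N}))"
      by (rule card_UN_le) simp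
    finally have "real N \<le> real (card (A \<inter> {1..N})) + (\<Sum>n<N. real (card (E n \<inter> {1..N})))"
      by (simp flip: of_nat_sum of_nat_add)
    also have "(\<Sum>n<N. real (card (E n \<inter> {1..N}))) \<le> (\<Sum>n<N. 2 * \<delta> n * real N)"
      by (intro sum_mono cardE)
    also have "\<dots> = \<epsilon> / 2 * (1 - 1 / 2 ^ N) * real N"
      by (simp add: sum\<delta> flip: sum_distrib_right)
    also have "\<dots> \<le> \<epsilon> / 2 * real N"
      using assms(3) by (intro mult_right_mono) (auto simp: field_simps)
    finally show "(1 - \<epsilon> / 2) * real N \<le> real (card (A \<inter> {1..N}))" by (simp add: algebra_simps)
  qed
  moreover have "finite B"
    if sub: "{poly P (of_nat b1) + of_nat b2 + of_int t | b1 b2. b1 \<in> B \<and> b2 \<in> B \<and> b1 < b2}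
         \<subseteq> (of_nat ` A :: rat set)" for B :: "nat set" and t :: int
  proof (rule ccontr)
    assume inf: "infinite B"
    define n where "n = int_encode t"
    have t: "int_decode n = t" by (simp add: n_def)
    have "finite ((\<lambda>b. b mod q n) ` B)"
      by (rule finite_subset[of _ "{..<q n}"]) (use q(1) in auto)
    then obtain b0 where b0: "b0 \<in> B" "infinite {b \<in> B. b mod q n = b0 mod q n}"
      using pigeonhole_infinite[OF inf] by blast
    obtain z where z: "poly P (of_nat b0) = of_int z"
      using assms(1) unfolding integer_valued_poly_def by (metis Ints_cases of_int_of_nat_eq)
    \<comment> \<open>This size gives \<open>b0 < b\<close> and also puts \<open>z + b + t\<close>
      beyond the cutoff of \<open>E n\<close>.\<close>
    obtain b where b: "b \<in> B" "b mod q n = b0 mod q n" "b > b0 + nat (int (q n + n + 1) - z - t)"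
      using b0(2) by (auto simp: infinite_nat_iff_unbounded)
    have "poly P (of_nat b0) + of_nat b + of_int t \<in> (of_nat ` A :: rat set)"
      using sub b0(1) b by force
    then obtain x where x: "x \<in> A" "poly P (of_nat b0) + of_nat b + of_int t = (of_nat x :: rat)"
      by auto
    hence "(of_int (z + int b + t) :: rat) = of_int (int x)" by (simp add: z)
    hence xz: "int x = z + int b + t" by (simp only: of_int_eq_iff)
    have "x \<ge> q n + n + 1" using xz b(3) by linarith
    moreover have "x \<in> shifted_values R D t (q n)"
    proof -
      \<comment> \<open>Replacing \<open>b\<close> by \<open>b0\<close> modulo \<open>q n\<close>
        turns \<open>D * (x - t) = D * (z + b)\<close> into the value of \<open>R\<close> at
        \<open>b0\<close>.\<close>
      have "(of_int (poly R (int b0)) :: rat) = of_int (D * (z + int b0))"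
        by (simp add: poly_R z)
      hence Rb0: "poly R (int b0) = D * (z + int b0)" by (simp only: of_int_eq_iff)
      have "[int b = int b0] (mod int (q n))" using b(2) by (simp add: cong_def flip: zmod_int)
      hence "[D * (z + int b) = D * (z + int b0)] (mod int (q n))"
        by (intro cong_mult cong_add) auto
      hence "D * (int x - t) mod int (q n) = poly R (int b0) mod int (q n)"
        by (simp add: xz Rb0 cong_def)
      thus ?thesis by (auto simp: shifted_values_def residue_image_def)
    qed
    ultimately have "x \<in> E n" by (simp add: E_def t)
    thus False using x(1) by (auto simp: A_def)
  qed
  ultimately show ?thesis using assms(3) by (intro exI[of _ A]) (auto simp: A_def)
qed

end
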